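(* Let $K\le N$ and let $\mathbf{H}\in\mathbb{C}^{K\times N}$ have full row rank, with $\bar{\mathbf{H}}=\mathbf{H}\mathbf{H}^{\mathsf H}$. For any pair $(\mathbf{W},\mathbf{p})\in\mathbb{C}^{N\times K}\times\mathbb{R}^K$ satisfying $$\mathbf{W}^{\mathsf H}\mathbf{W}\preceq\operatorname{diag}(\mathbf{p})\qquad(\ast)$$ and such that all columns of $\mathbf{W}$ lie in $\operatorname{Ran}(\mathbf{H}^{\mathsf H})$, there exists $\mathbf{Y}\in\mathbb{C}^{K\times K}$ such that $$\mathbf{W}=\mathbf{H}^{\mathsf H}\bar{\mathbf{H}}^{-1/2}\,\mathbf{Y}\operatorname{diag}(\sqrt{\mathbf{p}}),\qquad \|\mathbf{Y}\|_2\le 1.\qquad(\ast\ast)$$ Conversely, for any pair $(\mathbf{Y},\mathbf{p})\in\mathbb{C}^{K\times K}\times\mathbb{R}^K$ with $\|\mathbf{Y}\|_2\le1$ and $\mathbf{p}\ge\mathbf{0}$ entrywise, the matrix $\mathbf{W}$ defined by the first formula in $(\ast\ast)$ is such that $(\mathbf{W},\mathbf{p})$ satisfies $(\ast)$.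
   Context: $\preceq$ is the Loewner (positive semidefinite) order on Hermitian matrices, $\|\cdot\|_2$ is the spectral norm, $\bar{\mathbf{H}}^{-1/2}$ is the inverse of the Hermitian positive definite square root of $\bar{\mathbf{H}}$, and $\sqrt{\mathbf{p}}$ is the entrywise square root (condition $(\ast)$ forces $\mathbf{p}\ge\mathbf{0}$ entrywise). *)

theory Defs
  imports "HOL-Analysis.Analysis"
begin

text \<open>A \<^typ>\<open>complex ^ 'n ^ 'm\<close> has rows indexed by \<^typ>\<open>'m::finite\<close> and columns indexed by
  \<^typ>\<open>'n::finite\<close>.\<close>

definition conj_transpose :: "complex ^ 'n ^ 'm \<Rightarrow> complex ^ 'm ^ 'n" where
  "conj_transpose A = (\<chi> i j. cnj (A $ j $ i))"

definition hermitian :: "complex ^ 'n ^ 'n \<Rightarrow> bool" where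
  "hermitian A \<longleftrightarrow> conj_transpose A = A"

definition quad_form :: "complex ^ 'n ^ 'n \<Rightarrow> complex ^ 'n \<Rightarrow> complex" where
  "quad_form A x = (\<Sum>i\<in>UNIV. cnj (x $ i) * (A *v x) $ i)"

text \<open>The quadratic form of a Hermitian matrix is real-valued, so only its real part matters.\<close>

definition pos_semidef :: "complex ^ 'n ^ 'n \<Rightarrow> bool" where
  "pos_semidef A \<longleftrightarrow> hermitian A \<and> (\<forall>x. 0 \<le> Re (quad_form A x))"

definition pos_def :: "complex ^ 'n ^ 'n \<Rightarrow> bool" where
  "pos_def A \<longleftrightarrow> hermitian A \<and> (\<forall>x. x \<noteq> 0 \<longrightarrow> 0 < Re (quad_form A x))"

definition loewner_le :: "complex ^ 'n ^ 'n \<Rightarrow> complex ^ 'n ^ 'n \<Rightarrow> bool" (infix "\<preceq>\<^sub>L" 50) where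
  "A \<preceq>\<^sub>L B \<longleftrightarrow> hermitian A \<and> hermitian B \<and> pos_semidef (B - A)"

text \<open>Meaningful for positive definite arguments, for which the root exists and is unique.\<close>

definition pd_sqrt :: "complex ^ 'n ^ 'n \<Rightarrow> complex ^ 'n ^ 'n" where
  "pd_sqrt A = (THE S. pos_def S \<and> S ** S = A)"

definition inv_sqrt :: "complex ^ 'n ^ 'n \<Rightarrow> complex ^ 'n ^ 'n" where
  "inv_sqrt A = matrix_inv (pd_sqrt A)"

definition diag :: "real ^ 'n \<Rightarrow> complex ^ 'n ^ 'n" where
  "diag p = (\<chi> i j. if i = j then complex_of_real (p $ i) else 0)"

definition vec_sqrt :: "real ^ 'n \<Rightarrow> real ^ 'n" where
  "vec_sqrt p = (\<chi> i. sqrt (p $ i))"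

text \<open>The norm on \<^typ>\<open>complex ^ 'n\<close> is the Euclidean one, so the operator norm is the largest
  singular value.\<close>

definition spectral_norm :: "complex ^ 'n ^ 'm \<Rightarrow> real" where
  "spectral_norm A = onorm (\<lambda>x. A *v x)"

end

theory Submission
  imports Defs
begin

text \<open>Let \<open>R = inv_sqrt (H H\<^sup>*)\<close>. Then \<open>U = H\<^sup>* R\<close> is an isometry onto \<open>Ran H\<^sup>*\<close>, so a matrix \<open>W\<close> with
  columns in that range is \<open>U Z\<close> with \<open>W\<^sup>* W = Z\<^sup>* Z\<close>, and \<open>Z\<^sup>* Z \<preceq> diag p\<close> says that
  \<open>Z = Y diag (sqrt p)\<close> with \<open>Y\<close> a contraction: \<open>Y\<close> is \<open>Z\<close> times the pseudoinverse of \<open>diag (sqrt p)\<close>,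
  because the \<open>i\<close>-th column of \<open>Z\<close> vanishes when \<open>p i = 0\<close>.

  The positive definite square root is obtained without the spectral theorem. Scale \<open>A\<close> so that
  \<open>B = 1 - c A\<close> has norm below 1; then \<open>X \<mapsto> (B + X\<^sup>2) / 2\<close> is a contraction of a ball, and its fixed point
  satisfies \<open>(1 - X)\<^sup>2 = c A\<close>. The fixed point commutes with everything that commutes with \<open>A\<close>; this yields
  both complex linearity of the root and its uniqueness.\<close>

section \<open>Square roots of positive self-adjoint operators\<close>

lemma sqrt_contraction_operator:
  fixes B :: "'a::{real_inner, banach} \<Rightarrow>\<^sub>L 'a"
  assumes sa: "\<And>x y. B x \<bullet> y = x \<bullet> B y" and lt1: "norm B < 1"
  obtains X :: "'a \<Rightarrow>\<^sub>L 'a" where "norm X < 1"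
    "\<And>x y. blinfun_apply X x \<bullet> y = x \<bullet> blinfun_apply X y"
    "2 *\<^sub>R X = B + (X o\<^sub>L X)" "\<And>T. T o\<^sub>L B = B o\<^sub>L T \<Longrightarrow> T o\<^sub>L X = X o\<^sub>L T"
proof -
  define q where "q = norm B"
  have q: "0 \<le> q" "q < 1" using lt1 by (auto simp: q_def)
  define f where "f X = (1/2) *\<^sub>R (B + (X o\<^sub>L X))" for X :: "'a \<Rightarrow>\<^sub>L 'a"
  \<comment> \<open>Self-adjointness and the commutation property are closed conditions preserved by
    \<open>f\<close>, so building them into the complete set makes the fixed point inherit them. The
    ball of radius \<open>q\<close> is invariant because (q + q^2)/2 \<le> q.\<close>
  define \<S> where "\<S> = {X :: 'a \<Rightarrow>\<^sub>L 'a. norm X \<le> q \<and> (\<forall>x y. blinfun_apply X x \<bullet> y = x \<bullet> blinfun_apply X y) \<and>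
    (\<forall>T. T o\<^sub>L B = B o\<^sub>L T \<longrightarrow> T o\<^sub>L X = X o\<^sub>L T)}"
  have "closed \<S>"
    unfolding \<S>_def imp_conv_disj
    by (intro closed_Collect_conj closed_Collect_all closed_Collect_disj closed_Collect_const
        closed_Collect_le closed_Collect_eq continuous_intros)
  then have "complete \<S>" by (simp add: complete_eq_closed)
  moreover have "\<S> \<noteq> {}" using sa by (auto simp: \<S>_def q_def)
  moreover have "f X \<in> \<S>" if "X \<in> \<S>" for X
  proof -
    have X: "norm X \<le> q" "\<And>x y. X x \<bullet> y = x \<bullet> X y"
      and XT: "\<And>T. T o\<^sub>L B = B o\<^sub>L T \<Longrightarrow> T o\<^sub>L X = X o\<^sub>L T"
      using that by (auto simp: \<S>_def)
    have "norm (X o\<^sub>L X) \<le> norm X * norm X" by (rule norm_blinfun_compose)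
    also have "\<dots> \<le> q * 1" using X(1) q by (intro mult_mono) auto
    finally have "norm (B + (X o\<^sub>L X)) \<le> q + q"
      using norm_triangle_ineq[of B "X o\<^sub>L X"] by (simp add: q_def)
    then have "norm (f X) \<le> q" by (simp add: f_def)
    moreover have "f X x \<bullet> y = x \<bullet> f X y" for x y
      by (simp add: f_def blinfun.bilinear_simps inner_add_left inner_add_right X(2) sa)
    moreover have "T o\<^sub>L f X = f X o\<^sub>L T" if T: "T o\<^sub>L B = B o\<^sub>L T" for T
    proof (rule blinfun_eqI)
      fix x
      have "T (B x) = B (T x)" "\<And>x. T (X x) = X (T x)"
        using T XT[OF T] by (metis blinfun_apply_blinfun_compose)+
      then show "(T o\<^sub>L f X) x = (f X o\<^sub>L T) x"
        by (simp add: f_def blinfun.bilinear_simps)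
    qed
    ultimately show ?thesis by (simp add: \<S>_def)
  qed
  moreover have "dist (f X) (f Y) \<le> q * dist X Y" if "X \<in> \<S>" "Y \<in> \<S>" for X Y
  proof -
    have "norm X \<le> q" "norm Y \<le> q" using that by (auto simp: \<S>_def)
    \<comment> \<open>Noncommutative difference of squares, X^2 - Y^2 = X(X - Y) + (X - Y)Y: each
      summand contributes a factor at most \<open>q\<close>, so after halving the Lipschitz constant
      is \<open>q\<close>.\<close>
    have "f X - f Y = (1/2) *\<^sub>R ((X o\<^sub>L (X - Y)) + ((X - Y) o\<^sub>L Y))"
      by (rule blinfun_eqI) (simp add: f_def blinfun.bilinear_simps algebra_simps)
    then have "norm (f X - f Y) \<le> (norm (X o\<^sub>L (X - Y)) + norm ((X - Y) o\<^sub>L Y)) / 2"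
      using norm_triangle_ineq[of "X o\<^sub>L (X - Y)" "(X - Y) o\<^sub>L Y"] by simp
    also have "\<dots> \<le> (norm X * norm (X - Y) + norm (X - Y) * norm Y) / 2"
      by (intro divide_right_mono add_mono norm_blinfun_compose) auto
    also have "\<dots> \<le> (q * norm (X - Y) + norm (X - Y) * q) / 2"
      using \<open>norm X \<le> q\<close> \<open>norm Y \<le> q\<close>
      by (intro divide_right_mono add_mono mult_right_mono mult_left_mono) auto
    finally show ?thesis by (simp add: dist_norm)
  qed
  ultimately have "\<exists>!X\<in>\<S>. f X = X"
    using q by (intro Banach_fix) auto
  then obtain X where X: "X \<in> \<S>" "f X = X" by auto
  have "2 *\<^sub>R f X = B + (X o\<^sub>L X)" by (simp add: f_def)
  then have eq: "2 *\<^sub>R X = B + (X o\<^sub>L X)" by (simp only: X(2))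
  show thesis
    using X(1) q by (intro that[OF _ _ eq]) (auto simp: \<S>_def)
qed

lemma positive_operator_sqrt:
  fixes A :: "'a::{real_inner, banach} \<Rightarrow>\<^sub>L 'a"
  assumes sa: "\<And>x y. A x \<bullet> y = x \<bullet> A y"
    and m: "0 < m" "\<And>x. m * (norm x)\<^sup>2 \<le> x \<bullet> A x"
  obtains S :: "'a \<Rightarrow>\<^sub>L 'a" where "S o\<^sub>L S = A" "\<And>x y. blinfun_apply S x \<bullet> y = x \<bullet> blinfun_apply S y"
    "\<And>x. x \<noteq> 0 \<Longrightarrow> 0 < x \<bullet> blinfun_apply S x"
    "\<And>T. T o\<^sub>L A = A o\<^sub>L T \<Longrightarrow> T o\<^sub>L S = S o\<^sub>L T"
proof -
  \<comment> \<open>Adding \<open>m\<close> to the norm secures 0 < M and m \<le> M, hence q \<ge>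
    0. The choice c = m/M^2 minimises 1 - 2cm + c^2 M^2, the bound obtained for the squared norm of
    1 - cA; the minimum is \<open>q\<close>.\<close>
  define M where "M = norm A + m"
  define c where "c = m / M\<^sup>2"
  have M: "0 < M" "m \<le> M" "norm A \<le> M" using m by (auto simp: M_def add_nonneg_pos)
  have c: "0 < c" using m M by (simp add: c_def)
  define q where "q = 1 - m\<^sup>2 / M\<^sup>2"
  have q: "0 \<le> q" "q < 1" using m M by (auto simp: q_def divide_le_eq power_mono)
  define B where "B = id_blinfun - c *\<^sub>R A"
  have Bx: "B x = x - c *\<^sub>R A x" for x by (simp add: B_def blinfun.bilinear_simps)
  have sqB: "(norm (B x))\<^sup>2 \<le> q * (norm x)\<^sup>2" for x
  proof -
    have "norm (A x) \<le> M * norm x"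
      using norm_blinfun[of A x] M by (meson mult_right_mono norm_ge_zero order_trans)
    then have "(norm (A x))\<^sup>2 \<le> M\<^sup>2 * (norm x)\<^sup>2"
      using power_mono[of "norm (A x)" "M * norm x" 2] by (simp add: power_mult_distrib)
    then have A2: "c\<^sup>2 * (norm (A x))\<^sup>2 \<le> c\<^sup>2 * (M\<^sup>2 * (norm x)\<^sup>2)"
      by (intro mult_left_mono) auto
    have A1: "2 * c * (m * (norm x)\<^sup>2) \<le> 2 * c * (x \<bullet> A x)"
      using m(2)[of x] c by (intro mult_left_mono) auto
    have "(norm (B x))\<^sup>2 = (norm x)\<^sup>2 - 2 * c * (x \<bullet> A x) + c\<^sup>2 * (norm (A x))\<^sup>2"
      unfolding Bx power2_norm_eq_inner
      by (simp add: inner_diff_left inner_diff_right inner_commute power2_eq_square)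
    also have "\<dots> \<le> (norm x)\<^sup>2 - 2 * c * (m * (norm x)\<^sup>2) + c\<^sup>2 * (M\<^sup>2 * (norm x)\<^sup>2)"
      using A1 A2 by linarith
    also have "\<dots> = q * (norm x)\<^sup>2"
      using M by (simp add: c_def q_def field_simps power2_eq_square)
    finally show ?thesis .
  qed
  have "norm (B x) \<le> sqrt q * norm x" for x
    using real_sqrt_le_mono[OF sqB[of x]] by (simp add: real_sqrt_mult)
  then have "norm B \<le> sqrt q" using q by (intro norm_blinfun_bound) auto
  also have "\<dots> < 1" using q by simp
  finally have B1: "norm B < 1" .
  have Bsa: "B x \<bullet> y = x \<bullet> B y" for x y
    by (simp add: Bx inner_diff_left inner_diff_right sa)
  obtain X where X: "norm X < 1" "\<And>x y. blinfun_apply X x \<bullet> y = x \<bullet> blinfun_apply X y"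
      "2 *\<^sub>R X = B + (X o\<^sub>L X)"
    and XT: "\<And>T. T o\<^sub>L B = B o\<^sub>L T \<Longrightarrow> T o\<^sub>L X = X o\<^sub>L T"
    using sqrt_contraction_operator[OF Bsa B1] by blast
  define S where "S = (1 / sqrt c) *\<^sub>R (id_blinfun - X)"
  have Sx: "S x = (1 / sqrt c) *\<^sub>R (x - X x)" for x by (simp add: S_def blinfun.bilinear_simps)
  show thesis
  proof
    \<comment> \<open>The fixed-point equation gives (1 - X)^2 = 1 - 2X + X^2 = 1 - B = cA; dividing
      by \<open>sqrt c\<close> undoes the scaling.\<close>
    show "S o\<^sub>L S = A"
    proof (rule blinfun_eqI)
      fix x
      have "(2 *\<^sub>R X) x = (B + (X o\<^sub>L X)) x" using X(3) by simp
      then have XX: "X (X x) = 2 *\<^sub>R X x - B x" by (simp add: blinfun.bilinear_simps)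
      have "(S o\<^sub>L S) x = (1 / c) *\<^sub>R (x - 2 *\<^sub>R X x + X (X x))"
        using c by (simp add: Sx blinfun.bilinear_simps algebra_simps scaleR_2)
      also have "\<dots> = A x" using c by (simp add: XX Bx)
      finally show "(S o\<^sub>L S) x = A x" .
    qed
    show "S x \<bullet> y = x \<bullet> S y" for x y
      by (simp add: Sx inner_diff_left inner_diff_right X(2))
    show "0 < x \<bullet> S x" if "x \<noteq> 0" for x
    proof -
      have "x \<bullet> X x \<le> norm x * norm (X x)" by (rule norm_cauchy_schwarz)
      also have "\<dots> \<le> norm x * (norm X * norm x)" by (intro mult_left_mono norm_blinfun) auto
      also have "\<dots> < x \<bullet> x"
        using that X(1) by (simp add: dot_square_norm power2_eq_square)
      finally show ?thesis using c by (simp add: Sx inner_diff_right)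
    qed
    show "T o\<^sub>L S = S o\<^sub>L T" if T: "T o\<^sub>L A = A o\<^sub>L T" for T
    proof -
      have TA: "T (A x) = A (T x)" for x using T by (metis blinfun_apply_blinfun_compose)
      have "T o\<^sub>L B = B o\<^sub>L T" by (rule blinfun_eqI) (simp add: Bx blinfun.bilinear_simps TA)
      then have "T (X x) = X (T x)" for x using XT by (metis blinfun_apply_blinfun_compose)
      then show ?thesis by (intro blinfun_eqI) (simp add: Sx blinfun.bilinear_simps)
    qed
  qed
qed

section \<open>Hermitian matrices through the real inner product\<close>

lemma inner_complex_vec: "x \<bullet> y = Re (\<Sum>i\<in>UNIV. cnj (x $ i) * y $ i)" for x y :: "complex ^ 'n"
  by (simp add: inner_vec_def inner_complex_def)

lemma Re_quad_form: "Re (quad_form A x) = x \<bullet> (A *v x)"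
  by (simp add: quad_form_def inner_complex_vec)

lemma conj_transpose_conj_transpose [simp]: "conj_transpose (conj_transpose A) = A"
  by (simp add: conj_transpose_def vec_eq_iff)

lemma conj_transpose_mult: "conj_transpose (A ** B) = conj_transpose B ** conj_transpose A"
  by (simp add: conj_transpose_def matrix_matrix_mult_def vec_eq_iff mult.commute)

lemma inner_conj_transpose: "(conj_transpose A *v x) \<bullet> y = x \<bullet> (A *v y)"
  unfolding inner_complex_vec
  by (simp add: conj_transpose_def matrix_vector_mult_def sum_distrib_left sum_distrib_right
      mult_ac flip: Re_sum) (subst sum.swap, simp)

text \<open>The real part of the complex inner product is already nondegenerate, so it determines
  the adjoint. This lets the real operator theory above apply to complex matrices.\<close>

lemma hermitian_iff_inner: "hermitian A \<longleftrightarrow> (\<forall>x y. (A *v x) \<bullet> y = x \<bullet> (A *v y))"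
proof
  assume "hermitian A"
  then show "\<forall>x y. (A *v x) \<bullet> y = x \<bullet> (A *v y)"
    unfolding hermitian_def by (metis inner_conj_transpose)
next
  assume "\<forall>x y. (A *v x) \<bullet> y = x \<bullet> (A *v y)"
  then have "(conj_transpose A *v x) \<bullet> y = (A *v x) \<bullet> y" for x y
    by (simp add: inner_conj_transpose)
  then have "conj_transpose A *v x = A *v x" for x by (metis vector_eq_rdot)
  then show "hermitian A" by (simp add: hermitian_def matrix_eq)
qed

lemma hermitian_conj_transpose_mult: "hermitian (conj_transpose A ** A)"
  by (simp add: hermitian_def conj_transpose_mult)

lemma scaleR_eq_mult_of_real: "r *\<^sub>R x = complex_of_real r *s x" for x :: "complex ^ 'n"
  by (simp add: vec_eq_iff scaleR_conv_of_real[where 'a = complex])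

section \<open>Roots and inverse roots of positive definite matrices\<close>

text \<open>By compactness the quadratic form attains a positive minimum on the unit sphere, and
  homogeneity carries this bound to all vectors.\<close>

lemma pos_def_coercive:
  assumes "pos_def A"
  obtains m where "0 < m" "\<And>x. m * (norm x)\<^sup>2 \<le> x \<bullet> (A *v x)"
proof -
  have cont: "continuous_on (sphere 0 1) (\<lambda>x. x \<bullet> (A *v x))"
    by (intro continuous_intros linear_continuous_on) auto
  have "axis undefined 1 \<in> sphere (0::complex ^ 'a) 1" by (simp add: norm_axis_1)
  then have "sphere (0::complex ^ 'a) 1 \<noteq> {}" by blast
  from continuous_attains_inf[OF compact_sphere this cont]
  obtain u where u: "norm u = 1" "\<And>x. norm x = 1 \<Longrightarrow> u \<bullet> (A *v u) \<le> x \<bullet> (A *v x)"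
    by auto
  have "u \<noteq> 0" using u(1) by auto
  show thesis
  proof
    show "0 < u \<bullet> (A *v u)" using assms \<open>u \<noteq> 0\<close> by (simp add: pos_def_def Re_quad_form)
    show "u \<bullet> (A *v u) * (norm x)\<^sup>2 \<le> x \<bullet> (A *v x)" for x
    proof (cases "x = 0")
      case False
      then have "u \<bullet> (A *v u) \<le> sgn x \<bullet> (A *v sgn x)" by (intro u(2)) (simp add: norm_sgn)
      also have "\<dots> = (x \<bullet> (A *v x)) / (norm x)\<^sup>2"
        by (simp add: sgn_div_norm linear_scale[OF bounded_linear.linear] power2_eq_square divide_simps)
      finally show ?thesis using False by (simp add: field_simps)
    qed simp
  qed
qed

text \<open>Justifies the definite description in \<open>pd_sqrt\<close>.\<close>

lemma pos_def_sqrt_ex1: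
  assumes A: "pos_def A"
  shows "\<exists>!S. pos_def S \<and> S ** S = A"
proof -
  obtain m where m: "0 < m" "\<And>x. m * (norm x)\<^sup>2 \<le> x \<bullet> (A *v x)"
    using pos_def_coercive[OF A] by blast
  define op where "op = (\<lambda>M :: complex ^ 'a ^ 'a. Blinfun ((*v) M))"
  have op: "op M x = M *v x" for M x
    by (simp add: op_def bounded_linear_Blinfun_apply)
  \<comment> \<open>The root \<open>f\<close> is a priori only real linear. Complex scalar
    multiplication is itself a real-linear operator commuting with \<open>A\<close>, hence with
    \<open>f\<close>; so \<open>f\<close> is complex linear and comes from a matrix.\<close>
  define scal where "scal = (\<lambda>c :: complex. Blinfun (\<lambda>x :: complex ^ 'a. c *s x))"
  have "bounded_linear (\<lambda>x :: complex ^ 'a. c *s x)" for c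
    by (intro linear_conv_bounded_linear[THEN iffD1] linearI)
      (simp_all add: vec.scale_right_distrib scaleR_eq_mult_of_real mult.commute)
  then have scal: "scal c x = c *s x" for c x
    by (simp add: scal_def bounded_linear_Blinfun_apply)
  have "op A x \<bullet> y = x \<bullet> op A y" for x y
    using A by (simp add: op pos_def_def hermitian_iff_inner)
  moreover have "m * (norm x)\<^sup>2 \<le> x \<bullet> op A x" for x using m by (simp add: op)
  ultimately obtain f where f: "f o\<^sub>L f = op A" "\<And>x y. blinfun_apply f x \<bullet> y = x \<bullet> blinfun_apply f y"
      "\<And>x. x \<noteq> 0 \<Longrightarrow> 0 < x \<bullet> blinfun_apply f x"
    and comm: "\<And>T. T o\<^sub>L op A = op A o\<^sub>L T \<Longrightarrow> T o\<^sub>L f = f o\<^sub>L T"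
    using positive_operator_sqrt[of "op A" m] m(1) by blast
  have commD: "T (f x) = f (T x)" if "\<And>x. T (A *v x) = A *v T x" for T :: "(complex ^ 'a) \<Rightarrow>\<^sub>L (complex ^ 'a)" and x
  proof -
    have "T o\<^sub>L op A = op A o\<^sub>L T" by (rule blinfun_eqI) (simp add: op that)
    then show ?thesis using comm by (metis blinfun_apply_blinfun_compose)
  qed
  have "f (c *s x) = c *s f x" for c x
    using commD[of "scal c" x] by (simp add: scal vector_scalar_commute)
  then have "Vector_Spaces.linear (*s) (*s) f"
    by unfold_locales (auto simp: blinfun.bilinear_simps vec.scale_right_distrib vec.scale_left_distrib)
  define S where "S = matrix f"
  have S: "S *v x = f x" for x
    unfolding S_def by (rule matrix_works) fact
  show ?thesis
  proof (rule ex1I)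
    have "S ** S = A"
      unfolding matrix_eq using f(1) by (metis S op blinfun_apply_blinfun_compose matrix_vector_mul_assoc)
    then show "pos_def S \<and> S ** S = A"
      using f by (simp add: pos_def_def hermitian_iff_inner Re_quad_form S)
    fix T assume T: "pos_def T \<and> T ** T = A"
    \<comment> \<open>A competing root \<open>T\<close> commutes with T^2 = A, hence with
      \<open>f\<close>.\<close>
    have ST: "f (T *v x) = T *v f x" for x
      using commD[of "op T" x] T by (metis op matrix_vector_mul_assoc)
    have "T *v x = f x" for x
    proof (rule ccontr)
      assume neq: "T *v x \<noteq> f x"
      define y where "y = f x - T *v x"
      \<comment> \<open>As \<open>f\<close> and \<open>T\<close> commute, \<open>(f + T)(f - T) = f\<^sup>2 - T\<^sup>2 = 0\<close>.\<close>
      have "f (f x) = T *v (T *v x)"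
        using f(1) T by (metis op blinfun_apply_blinfun_compose matrix_vector_mul_assoc)
      then have "f y + T *v y = 0"
        by (simp add: y_def blinfun.bilinear_simps matrix_vector_mult_diff_distrib ST)
      then have "y \<bullet> f y + y \<bullet> (T *v y) = 0" by (metis inner_add_right inner_zero_right)
      moreover have "y \<noteq> 0" using neq by (simp add: y_def)
      then have "0 < y \<bullet> f y" "0 < y \<bullet> (T *v y)"
        using f(3) T by (auto simp: pos_def_def Re_quad_form)
      ultimately show False by simp
    qed
    then show "T = S" by (simp add: matrix_eq S)
  qed
qed

lemma inv_sqrt:
  assumes "pos_def A"
  obtains S where "S ** S = A" "S ** inv_sqrt A = mat 1" "inv_sqrt A ** S = mat 1"
    "hermitian (inv_sqrt A)"
proof -
  define S where "S = pd_sqrt A"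
  have S: "pos_def S" "S ** S = A"
    using theI'[OF pos_def_sqrt_ex1[OF assms]] by (auto simp: S_def pd_sqrt_def)
  have "x = 0" if "S *v x = 0" for x
    using S(1) that by (fastforce simp: pos_def_def Re_quad_form)
  then have "\<exists>B. B ** S = mat 1" by (simp add: matrix_left_invertible_ker)
  then have "\<exists>B. S ** B = mat 1 \<and> B ** S = mat 1" by (metis matrix_left_right_inverse)
  then have inv: "S ** inv_sqrt A = mat 1" "inv_sqrt A ** S = mat 1"
    unfolding inv_sqrt_def matrix_inv_def S_def by (metis (mono_tags, lifting) someI_ex)+
  have Sv: "S *v (inv_sqrt A *v x) = x" for x
    by (simp add: matrix_vector_mul_assoc inv)
  \<comment> \<open>With R the inverse of S: Rx . y = Rx . SRy = SRx . Ry = x . Ry.\<close>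
  have "(inv_sqrt A *v x) \<bullet> y = x \<bullet> (inv_sqrt A *v y)" for x y
    using S(1) Sv by (metis pos_def_def hermitian_iff_inner)
  then have "hermitian (inv_sqrt A)" by (simp add: hermitian_iff_inner)
  with S inv that show thesis by blast
qed

section \<open>Full row rank makes the Gram matrix positive definite\<close>

text \<open>A nonzero coefficient would put one row in the span of the others, bounding the rank by
  one less than the number of rows. Coefficients are indexed by position, so repeated rows are
  covered too.\<close>

lemma full_row_rank_independent:
  fixes A :: "'a::field ^ 'n ^ 'm"
  assumes "rank A = CARD('m)" and sum0: "(\<Sum>i\<in>UNIV. c i *s row i A) = 0"
  shows "c i = 0"
proof (rule ccontr)
  assume ci: "c i \<noteq> 0"
  define R where "R = (\<lambda>j. row j A) ` (UNIV - {i})"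
  have "c i *s row i A = - (\<Sum>j\<in>UNIV - {i}. c j *s row j A)"
    using sum0 by (simp add: sum.remove[of UNIV i] eq_neg_iff_add_eq_0)
  moreover have "(\<Sum>j\<in>UNIV - {i}. c j *s row j A) \<in> vec.span R"
    unfolding R_def by (intro vec.span_sum vec.span_scale vec.span_base) auto
  ultimately have "c i *s row i A \<in> vec.span R" by (metis vec.span_neg)
  then have "row i A \<in> vec.span R"
    using ci vec.span_scale[of "c i *s row i A" R "inverse (c i)"] by simp
  moreover have "row j A \<in> vec.span R" if "j \<noteq> i" for j
    using that unfolding R_def by (intro vec.span_base) auto
  ultimately have "row j A \<in> vec.span R" for j by (cases "j = i") auto
  then have "rows A \<subseteq> vec.span R" by (auto simp: rows_def)
  then have "rank A \<le> card R"
    unfolding row_rank_def_gen by (intro vec.dim_le_card) (auto simp: R_def)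
  also have "\<dots> \<le> card (UNIV - {i})" unfolding R_def by (intro card_image_le) simp
  also have "\<dots> < CARD('m)" by (intro psubset_card_mono) auto
  finally show False using assms by simp
qed

lemma full_row_rank_pos_def:
  fixes H :: "complex ^ 'n ^ 'k"
  assumes "rank H = CARD('k)"
  shows "pos_def (H ** conj_transpose H)"
proof -
  have "0 < x \<bullet> ((H ** conj_transpose H) *v x)" if "x \<noteq> 0" for x
  proof -
    have "conj_transpose H *v x \<noteq> 0"
    proof
      assume *: "conj_transpose H *v x = 0"
      \<comment> \<open>Conjugating the entries of \<open>conj_transpose H *v x\<close> turns its
        vanishing into a linear relation among the rows of \<open>H\<close> with coefficients
        \<open>cnj (x $ i)\<close>.\<close>
      have "cnj (x $ i) = 0" for i
      proof (rule full_row_rank_independent[OF assms])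
        have "cnj ((conj_transpose H *v x) $ j) = 0" for j by (simp add: *)
        then show "(\<Sum>i\<in>UNIV. cnj (x $ i) *s row i H) = 0"
          by (simp add: vec_eq_iff matrix_vector_mult_def conj_transpose_def row_def mult.commute)
      qed
      with that show False by (simp add: vec_eq_iff)
    qed
    then show ?thesis
      using inner_conj_transpose[of H x "conj_transpose H *v x"]
      by (simp flip: matrix_vector_mul_assoc) (metis inner_gt_zero_iff)
  qed
  then show ?thesis
    using hermitian_conj_transpose_mult[of "conj_transpose H"]
    by (simp add: pos_def_def Re_quad_form)
qed

section \<open>Diagonal Loewner bounds and contractions\<close>

lemma diag_mult_vec: "diag p *v x = (\<chi> i. p $ i *\<^sub>R x $ i)"
  by (simp add: diag_def matrix_vector_mult_def vec_eq_iff if_distrib if_distribR scaleR_conv_of_real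
      cong: if_cong)

lemma diag_mult_diag: "diag p ** diag q = diag (\<chi> i. p $ i * q $ i)"
  by (simp add: matrix_eq diag_mult_vec flip: matrix_vector_mul_assoc)

lemma hermitian_diag: "hermitian (diag p)"
  by (simp add: hermitian_def diag_def conj_transpose_def vec_eq_iff)

lemma inner_diag: "x \<bullet> (diag p *v x) = (\<Sum>i\<in>UNIV. p $ i * (norm (x $ i))\<^sup>2)"
  by (simp add: diag_mult_vec inner_vec_def power2_norm_eq_inner)

lemma gram_le_diag_iff:
  "conj_transpose W ** W \<preceq>\<^sub>L diag p \<longleftrightarrow> (\<forall>x. (norm (W *v x))\<^sup>2 \<le> (\<Sum>i\<in>UNIV. p $ i * (norm (x $ i))\<^sup>2))"
proof -
  have "x \<bullet> ((conj_transpose W ** W) *v x) = (norm (W *v x))\<^sup>2" for x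
    using inner_conj_transpose[of "conj_transpose W" x "W *v x"]
    by (simp add: power2_norm_eq_inner flip: matrix_vector_mul_assoc)
  moreover have "hermitian (diag p - conj_transpose W ** W)"
    using hermitian_diag[of p] hermitian_conj_transpose_mult[of W]
    by (simp add: hermitian_def conj_transpose_def vec_eq_iff)
  ultimately show ?thesis
    by (simp add: loewner_le_def pos_semidef_def hermitian_diag hermitian_conj_transpose_mult
        Re_quad_form matrix_vector_mult_diff_rdistrib inner_diff_right inner_diag)
qed

lemma spectral_norm_le_1_iff: "spectral_norm Y \<le> 1 \<longleftrightarrow> (\<forall>x. norm (Y *v x) \<le> norm x)"
proof
  assume le: "spectral_norm Y \<le> 1"
  show "\<forall>x. norm (Y *v x) \<le> norm x"
  proof
    fix x
    have "norm (Y *v x) \<le> spectral_norm Y * norm x"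
      unfolding spectral_norm_def by (rule onorm) simp
    also have "\<dots> \<le> 1 * norm x" using le by (intro mult_right_mono) auto
    finally show "norm (Y *v x) \<le> norm x" by simp
  qed
next
  assume "\<forall>x. norm (Y *v x) \<le> norm x"
  then show "spectral_norm Y \<le> 1" unfolding spectral_norm_def by (intro onorm_le) simp
qed

text \<open>A diagonal case of the Douglas factorization lemma.\<close>

lemma gram_le_diag_factor:
  fixes Z :: "complex ^ 'k ^ 'm"
  assumes Z: "\<And>x. (norm (Z *v x))\<^sup>2 \<le> (\<Sum>i\<in>UNIV. p $ i * (norm (x $ i))\<^sup>2)"
  obtains Y where "Z = Y ** diag (vec_sqrt p)" "spectral_norm Y \<le> 1"
proof -
  \<comment> \<open>Testing on a coordinate vector bounds the squared norm of column
    \<open>i\<close> by \<open>p $ i\<close>. Hence \<open>p\<close> is nonnegative, and a column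
    vanishes where its bound is zero.\<close>
  have "(\<Sum>j\<in>UNIV. p $ j * (norm (axis i (1::complex) $ j))\<^sup>2) = p $ i" for i
    by (simp add: axis_def if_distrib[of norm] if_distrib[of "\<lambda>t. t\<^sup>2"]
        if_distrib[of "(*) _"] cong: if_cong)
  then have col: "(norm (Z *v axis i 1))\<^sup>2 \<le> p $ i" for i using Z[of "axis i 1"] by simp
  then have p: "0 \<le> p $ i" for i by (meson order_trans zero_le_power2)
  have col0: "Z $ j $ i = 0" if "p $ i = 0" for i j
  proof -
    have "Z *v axis i 1 = 0" using col[of i] that by simp
    moreover have "(Z *v axis i 1) $ j = Z $ j $ i"
      by (simp add: matrix_vector_mult_def axis_def if_distrib cong: if_cong)
    ultimately show ?thesis by simp
  qed
  \<comment> \<open>Since \<open>1 / 0 = 0\<close>, this is the pseudoinverse of \<open>diag (vec_sqrt p)\<close>.\<close>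
  define d where "d = (\<chi> i. 1 / sqrt (p $ i))"
  show thesis
  proof
    \<comment> \<open>The product of the two diagonal matrices erases exactly the coordinates with
      \<open>p $ i = 0\<close>, which \<open>Z\<close> annihilates anyway.\<close>
    have "Z *v x = Z *v (diag d *v (diag (vec_sqrt p) *v x))" for x
    proof -
      have "Z $ j $ i * x $ i = Z $ j $ i * (diag d *v (diag (vec_sqrt p) *v x)) $ i" for i j
        using col0[of i j] by (cases "p $ i = 0") (simp_all add: diag_mult_vec d_def vec_sqrt_def)
      then show ?thesis by (simp only: matrix_vector_mult_def[of Z])
    qed
    then show "Z = (Z ** diag d) ** diag (vec_sqrt p)"
      by (simp add: matrix_eq flip: matrix_vector_mul_assoc)
    have "norm ((Z ** diag d) *v x) \<le> norm x" for x
    proof -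
      have "(norm ((Z ** diag d) *v x))\<^sup>2 \<le> (\<Sum>i\<in>UNIV. p $ i * (norm ((diag d *v x) $ i))\<^sup>2)"
        using Z[of "diag d *v x"] by (simp add: matrix_vector_mul_assoc)
      also have "\<dots> \<le> (\<Sum>i\<in>UNIV. (norm (x $ i))\<^sup>2)"
      proof (rule sum_mono)
        show "p $ i * (norm ((diag d *v x) $ i))\<^sup>2 \<le> (norm (x $ i))\<^sup>2" for i
          using p[of i] by (cases "p $ i = 0")
            (simp_all add: diag_mult_vec d_def norm_divide power_divide)
      qed
      also have "\<dots> = (norm x)\<^sup>2" by (simp add: norm_vec_def L2_set_def sum_nonneg)
      finally show ?thesis by (simp add: abs_le_square_iff[symmetric])
    qed
    then show "spectral_norm (Z ** diag d) \<le> 1" by (simp add: spectral_norm_le_1_iff)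
  qed
qed

section \<open>The parametrization of \<open>W\<close>\<close>

lemma columns_in_range_factor:
  fixes A :: "'a::semiring_1 ^ 'n ^ 'm" and W :: "'a ^ 'k ^ 'm"
  assumes "columns W \<subseteq> range ((*v) A)"
  obtains V where "W = A ** V"
proof -
  have "\<forall>j. \<exists>v. column j W = A *v v" using assms by (auto simp: columns_def)
  then obtain v where v: "\<And>j. column j W = A *v v j" by metis
  have "W = A ** (\<chi> i j. v j $ i)"
    using v by (simp add: vec_eq_iff column_def matrix_vector_mult_def matrix_matrix_mult_def)
  then show thesis by (rule that)
qed

theorem proposition2:
  fixes H :: "complex ^ 'n ^ 'k"
  assumes "CARD('k) \<le> CARD('n)"
    and "rank H = CARD('k)"
  defines "Hbar \<equiv> H ** conj_transpose H"
  shows "(\<forall>(W :: complex ^ 'k ^ 'n) (p :: real ^ 'k).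
            conj_transpose W ** W \<preceq>\<^sub>L diag p \<longrightarrow>
            columns W \<subseteq> range (\<lambda>v. conj_transpose H *v v) \<longrightarrow>
            (\<exists>Y :: complex ^ 'k ^ 'k.
               W = conj_transpose H ** inv_sqrt Hbar ** Y ** diag (vec_sqrt p) \<and>
               spectral_norm Y \<le> 1))
       \<and> (\<forall>(Y :: complex ^ 'k ^ 'k) (p :: real ^ 'k) (W :: complex ^ 'k ^ 'n).
            spectral_norm Y \<le> 1 \<longrightarrow> (\<forall>i. 0 \<le> p $ i) \<longrightarrow>
            W = conj_transpose H ** inv_sqrt Hbar ** Y ** diag (vec_sqrt p) \<longrightarrow>
            conj_transpose W ** W \<preceq>\<^sub>L diag p)"
proof -
  obtain S where S: "S ** S = Hbar" "S ** inv_sqrt Hbar = mat 1" "inv_sqrt Hbar ** S = mat 1"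
    and R: "hermitian (inv_sqrt Hbar)"
    using inv_sqrt full_row_rank_pos_def[OF assms(2)] unfolding Hbar_def by metis
  define U where "U = conj_transpose H ** inv_sqrt Hbar"
  \<comment> \<open>With R = \<open>inv_sqrt Hbar\<close> and Hbar = S^2, this is (RS)(SR) =
    1.\<close>
  have "conj_transpose U ** U = inv_sqrt Hbar ** Hbar ** inv_sqrt Hbar"
    using R by (simp add: U_def conj_transpose_mult hermitian_def Hbar_def matrix_mul_assoc)
  also have "\<dots> = mat 1" using S by (metis matrix_mul_assoc matrix_mul_lid)
  finally have UU: "conj_transpose U ** U = mat 1" .
  have iso: "norm (U *v x) = norm x" for x
    using inner_conj_transpose[of "conj_transpose U" x "U *v x"]
    by (simp add: norm_eq_sqrt_inner matrix_vector_mul_assoc UU)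
  show ?thesis
  proof (intro conjI allI impI)
    fix W :: "complex ^ 'k ^ 'n" and p :: "real ^ 'k"
    assume W: "conj_transpose W ** W \<preceq>\<^sub>L diag p"
      and "columns W \<subseteq> range (\<lambda>v. conj_transpose H *v v)"
    then obtain V where "W = conj_transpose H ** V" using columns_in_range_factor by blast
    \<comment> \<open>Inserting RS = 1 into \<open>conj_transpose H ** V\<close> gives the
      coordinates \<open>S ** V\<close> of \<open>W\<close> relative to the isometry
      \<open>U\<close>; they satisfy the same norm bound as \<open>W\<close>.\<close>
    then have UW: "W = U ** (S ** V)"
      using S(3) unfolding U_def by (metis matrix_mul_assoc matrix_mul_rid)
    then have "norm (W *v x) = norm ((S ** V) *v x)" for x
      by (simp add: iso flip: matrix_vector_mul_assoc)
    then have "(norm ((S ** V) *v x))\<^sup>2 \<le> (\<Sum>i\<in>UNIV. p $ i * (norm (x $ i))\<^sup>2)" for x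
      using W by (simp add: gram_le_diag_iff)
    then obtain Y where "S ** V = Y ** diag (vec_sqrt p)" "spectral_norm Y \<le> 1"
      using gram_le_diag_factor by blast
    then show "\<exists>Y. W = conj_transpose H ** inv_sqrt Hbar ** Y ** diag (vec_sqrt p) \<and>
        spectral_norm Y \<le> 1"
      using UW by (metis U_def matrix_mul_assoc)
  next
    fix Y :: "complex ^ 'k ^ 'k" and p :: "real ^ 'k" and W :: "complex ^ 'k ^ 'n"
    assume Y: "spectral_norm Y \<le> 1" and p: "\<forall>i. 0 \<le> p $ i"
      and W: "W = conj_transpose H ** inv_sqrt Hbar ** Y ** diag (vec_sqrt p)"
    have "(norm (W *v x))\<^sup>2 \<le> (\<Sum>i\<in>UNIV. p $ i * (norm (x $ i))\<^sup>2)" for x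
    proof -
      have "norm (W *v x) = norm (Y *v (diag (vec_sqrt p) *v x))"
        unfolding W U_def[symmetric] by (simp add: iso flip: matrix_vector_mul_assoc)
      also have "\<dots> \<le> norm (diag (vec_sqrt p) *v x)" using Y by (simp add: spectral_norm_le_1_iff)
      finally have "(norm (W *v x))\<^sup>2 \<le> (norm (diag (vec_sqrt p) *v x))\<^sup>2"
        by (intro power_mono) auto
      also have "\<dots> = (\<Sum>i\<in>UNIV. p $ i * (norm (x $ i))\<^sup>2)"
        using p by (simp add: diag_mult_vec vec_sqrt_def norm_vec_def L2_set_def sum_nonneg
            power_mult_distrib)
      finally show ?thesis .
    qed
    then show "conj_transpose W ** W \<preceq>\<^sub>L diag p" by (simp add: gram_le_diag_iff)
  qed
qed

end
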